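(* Let $V\in\Gamma_{sc}(\mathbb{R}^m)$ and $(\overline{x},\overline{\sigma})\in\mathbb{R}^n\times\operatorname{int}(\operatorname{dom}V^* )$. (i) Assume that $(\overline{x},\overline{\sigma})$ is a critical point of $\Xi$. Then $(\overline{x},\overline{\sigma})\in X_0\times S_{\mathrm{col}}$, $\overline{x}$ is a critical point of $f$, and $f(\overline{x})=\Xi(\overline{x},\overline{\sigma})=D(\overline{\sigma})$; moreover, if $\overline{\sigma}\in S_0$ then $\overline{\sigma}$ is a critical point of $D$. (ii) Assume that $(\overline{x},\overline{\sigma})$ is a critical point of $\Xi$ such that $A(\overline{\sigma})\succeq0$. Then $\overline{\sigma}\in S_{\mathrm{col}}^+$ and $$f(\overline{x})=\inf_{x\in\operatorname{dom}f}f(x)=\Xi(\overline{x},\overline{\sigma})=\sup_{\sigma\in S_{\mathrm{col}}^+}D(\sigma)=D(\overline{\sigma});$$ moreover, if $A(\overline{\sigma})\succ0$ then $\overline{x}$ is the unique global solution of the problem of minimizing $f(x)$ over $x\in\mathbb{R}^n$. (iii) Assume that $\overline{\sigma}\in S_0$ and $\overline{\sigma}$ is a critical point of $D$. Then $(\overline{x},\overline{\sigma})$ is a critical point of $\Xi$, where $\overline{x}:=A(\overline{\sigma})^{-1}b(\overline{\sigma})$; therefore the conclusions of (i) hold for this pair, and also those of (ii) if $A(\overline{\sigma})\succeq0$ (respectively $A(\overline\sigma)\succ0$).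
   Context: $\Gamma(\mathbb{R}^m)$ is the class of proper convex lower semicontinuous functions $g:\mathbb{R}^m\to\overline{\mathbb{R}}=\mathbb{R}\cup\{-\infty,+\infty\}$; $\operatorname{dom}g=\{y: g(y)<\infty\}$; $g^*(\sigma)=\sup_{y}\{\langle y,\sigma\rangle-g(y)\}$ is the Fenchel conjugate. $\Gamma_{sc}(\mathbb{R}^m)$ is the class of $g\in\Gamma(\mathbb{R}^m)$ of Legendre type, i.e. essentially smooth ($\operatorname{int}(\operatorname{dom}g)\ne\emptyset$, $g$ differentiable there, and $\|\nabla g(y_k)\|\to\infty$ whenever $(y_k)\subset\operatorname{int}(\operatorname{dom}g)$ converges to a boundary point of $\operatorname{int}(\operatorname{dom}g)$) and essentially strictly convex (strictly convex on every convex subset of $\{y:\partial g(y)\neq\emptyset\}$). For $g\in\Gamma_{sc}(\mathbb{R}^m)$ one has $g^*\in\Gamma_{sc}(\mathbb{R}^m)$ and $\nabla g:\operatorname{int}(\operatorname{dom}g)\to\operatorname{int}(\operatorname{dom}g^* )$ is a bijection with inverse $\nabla g^*$. For $i\in\{0,\dots,m\}$ let $q_i(x)=\tfrac12\langle x,A_ix\rangle-\langle b_i,x\rangle+c_i$ on $\mathbb{R}^n$, with $A_i$ a real symmetric $n\times n$ matrix, $b_i\in\mathbb{R}^n$, $c_i\in\mathbb{R}$, and $q(x)=(q_1(x),\dots,q_m(x))^T$. Let $f:=q_0+V\circ q$, $\operatorname{dom}f=\{x: f(x)<\infty\}$, and $X_0:=\{x\in\mathbb{R}^n: q(x)\in\operatorname{int}(\operatorname{dom}V)\}$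 (an open set on which $f$ is differentiable). For $\sigma\in\mathbb{R}^m$ put, with $\sigma_0:=1$, $A(\sigma)=\sum_{k=0}^m\sigma_kA_k$, $b(\sigma)=\sum_{k=0}^m\sigma_kb_k$, $c(\sigma)=\sum_{k=0}^m\sigma_kc_k$, and let $$\Xi(x,\sigma)=q_0(x)+\langle q(x),\sigma\rangle-V^*(\sigma)=\tfrac12\langle x,A(\sigma)x\rangle-\langle b(\sigma),x\rangle+c(\sigma)-V^*(\sigma).$$ Sets: $S_0=\{\sigma\in\operatorname{dom}V^*:\det A(\sigma)\neq0\}$; $S_{\mathrm{col}}=\{\sigma\in\operatorname{dom}V^*: b(\sigma)\in\operatorname{Im}A(\sigma)\}$; $S_{\mathrm{col}}^+=\{\sigma\in S_{\mathrm{col}}:A(\sigma)\succeq0\}$. The dual function is $D:S_{\mathrm{col}}\to\mathbb{R}$, $D(\sigma):=\Xi(x,\sigma)$ for any $x$ with $A(\sigma)x=b(\sigma)$ (the value does not depend on the choice of such $x$); it is differentiable on the open set $S_0\cap\operatorname{int}(\operatorname{dom}V^* )$. A critical point is a point where the function is differentiable with zero gradient; for $\Xi$ the gradient is with respect to $(x,\sigma)\in\mathbb{R}^n\times\operatorname{int}(\operatorname{dom}V^* )$. *)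

theory Defs
  imports "HOL-Analysis.Analysis"
begin

section \<open>Convex analysis of extended-real-valued functions\<close>

definition edom :: "('a \<Rightarrow> ereal) \<Rightarrow> 'a set" where
  "edom g = {y. g y < \<infinity>}"

definition proper :: "('a \<Rightarrow> ereal) \<Rightarrow> bool" where
  "proper g \<longleftrightarrow> edom g \<noteq> {} \<and> (\<forall>y. g y \<noteq> - \<infinity>)"

definition convex_fun :: "('a::real_vector \<Rightarrow> ereal) \<Rightarrow> bool" where
  "convex_fun g \<longleftrightarrow> convex {(y, t::real). g y \<le> ereal t}"

definition lsc :: "('a::topological_space \<Rightarrow> ereal) \<Rightarrow> bool" where
  "lsc g \<longleftrightarrow> (\<forall>y. g y \<le> Liminf (at y) g)"

definition Gamma :: "('a::euclidean_space \<Rightarrow> ereal) set" where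
  "Gamma = {g. proper g \<and> convex_fun g \<and> lsc g}"

definition conjugate :: "('a::real_inner \<Rightarrow> ereal) \<Rightarrow> 'a \<Rightarrow> ereal" where
  "conjugate g \<sigma> = (SUP y. ereal (y \<bullet> \<sigma>) - g y)"

definition subdifferential :: "('a::real_inner \<Rightarrow> ereal) \<Rightarrow> 'a \<Rightarrow> 'a set" where
  "subdifferential g y =
     {v. \<bar>g y\<bar> \<noteq> \<infinity> \<and> (\<forall>z. g y + ereal (v \<bullet> (z - y)) \<le> g z)}"

text \<open>
  \<open>has_gradient_on U g y v\<close>: the function \<open>g\<close>, regarded as defined on \<open>U\<close> only, is defined and
  finite on a neighbourhood of \<open>y\<close> and is differentiable at \<open>y\<close> with gradient \<open>v\<close>.  Neither the
  values of \<open>g\<close> outside \<open>U\<close> nor the convention \<open>real_of_ereal (\<plusminus>\<infinity>) = 0\<close> plays a role.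
\<close>

definition has_gradient_on ::
    "'a set \<Rightarrow> ('a::real_inner \<Rightarrow> ereal) \<Rightarrow> 'a \<Rightarrow> 'a \<Rightarrow> bool" where
  "has_gradient_on U g y v \<longleftrightarrow>
     (\<forall>\<^sub>F z in nhds y. z \<in> U \<and> \<bar>g z\<bar> \<noteq> \<infinity>) \<and> (GDERIV (\<lambda>z. real_of_ereal (g z)) y :> v)"

definition gradient :: "('a::real_inner \<Rightarrow> ereal) \<Rightarrow> 'a \<Rightarrow> 'a" where
  "gradient g y = (THE v. has_gradient_on (edom g) g y v)"

definition critical_point_on :: "'a set \<Rightarrow> ('a::real_inner \<Rightarrow> ereal) \<Rightarrow> 'a \<Rightarrow> bool" where
  "critical_point_on U g y \<longleftrightarrow> has_gradient_on U g y 0"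

definition essentially_smooth :: "('a::euclidean_space \<Rightarrow> ereal) \<Rightarrow> bool" where
  "essentially_smooth g \<longleftrightarrow>
     interior (edom g) \<noteq> {} \<and>
     (\<forall>y\<in>interior (edom g). \<exists>v. has_gradient_on (edom g) g y v) \<and>
     (\<forall>Y y. (\<forall>k::nat. Y k \<in> interior (edom g)) \<longrightarrow> y \<in> frontier (interior (edom g)) \<longrightarrow>
        Y \<longlonglongrightarrow> y \<longrightarrow> filterlim (\<lambda>k. norm (gradient g (Y k))) at_top sequentially)"

definition strictly_convex_on :: "'a::real_vector set \<Rightarrow> ('a \<Rightarrow> ereal) \<Rightarrow> bool" where
  "strictly_convex_on C g \<longleftrightarrow>
     (\<forall>y\<in>C. \<forall>z\<in>C. \<forall>t::real. y \<noteq> z \<longrightarrow> 0 < t \<longrightarrow> t < 1 \<longrightarrow>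
        g ((1 - t) *\<^sub>R y + t *\<^sub>R z) < ereal (1 - t) * g y + ereal t * g z)"

definition essentially_strictly_convex :: "('a::euclidean_space \<Rightarrow> ereal) \<Rightarrow> bool" where
  "essentially_strictly_convex g \<longleftrightarrow>
     (\<forall>C. convex C \<longrightarrow> C \<subseteq> {y. subdifferential g y \<noteq> {}} \<longrightarrow> strictly_convex_on C g)"

definition Gamma_sc :: "('a::euclidean_space \<Rightarrow> ereal) set" where
  "Gamma_sc = {g \<in> Gamma. essentially_smooth g \<and> essentially_strictly_convex g}"

section \<open>Matrices\<close>

definition symmetric_matrix :: "real^'n^'n \<Rightarrow> bool" where
  "symmetric_matrix M \<longleftrightarrow> transpose M = M"

definition pos_semidef :: "real^'n^'n \<Rightarrow> bool" where
  "pos_semidef M \<longleftrightarrow> symmetric_matrix M \<and> (\<forall>x. 0 \<le> x \<bullet> (M *v x))"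

definition pos_def :: "real^'n^'n \<Rightarrow> bool" where
  "pos_def M \<longleftrightarrow> symmetric_matrix M \<and> (\<forall>x. x \<noteq> 0 \<longrightarrow> 0 < x \<bullet> (M *v x))"

section \<open>The primal, total and dual functions\<close>

text \<open>
  The coordinates of \<open>\<real>\<^sup>m\<close> are indexed by the finite type \<open>'m\<close>, and the index set \<open>{0, \<dots>, m}\<close>
  by \<open>'m option\<close>, with \<open>None\<close> in the role of \<open>0\<close>.
\<close>

definition quad :: "('i \<Rightarrow> real^'n^'n) \<Rightarrow> ('i \<Rightarrow> real^'n) \<Rightarrow> ('i \<Rightarrow> real) \<Rightarrow> 'i \<Rightarrow> real^'n \<Rightarrow> real"
  where "quad A b c i x = 1/2 * (x \<bullet> (A i *v x)) - b i \<bullet> x + c i"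

definition quad_vec ::
    "('m option \<Rightarrow> real^'n^'n) \<Rightarrow> ('m option \<Rightarrow> real^'n) \<Rightarrow> ('m option \<Rightarrow> real) \<Rightarrow> real^'n \<Rightarrow> real^'m"
  where "quad_vec A b c x = (\<chi> i. quad A b c (Some i) x)"

definition primal ::
    "('m option \<Rightarrow> real^'n^'n) \<Rightarrow> ('m option \<Rightarrow> real^'n) \<Rightarrow> ('m option \<Rightarrow> real) \<Rightarrow>
     (real^'m \<Rightarrow> ereal) \<Rightarrow> real^'n \<Rightarrow> ereal"
  where "primal A b c V x = ereal (quad A b c None x) + V (quad_vec A b c x)"

definition X0 ::
    "('m option \<Rightarrow> real^'n^'n) \<Rightarrow> ('m option \<Rightarrow> real^'n) \<Rightarrow> ('m option \<Rightarrow> real) \<Rightarrow>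
     (real^'m \<Rightarrow> ereal) \<Rightarrow> (real^'n) set"
  where "X0 A b c V = {x. quad_vec A b c x \<in> interior (edom V)}"

definition weight :: "real^'m \<Rightarrow> 'm option \<Rightarrow> real" where
  "weight \<sigma> k = (case k of None \<Rightarrow> 1 | Some i \<Rightarrow> \<sigma> $ i)"

text \<open>\<open>A(\<sigma>)\<close>, \<open>b(\<sigma>)\<close> and \<open>c(\<sigma>)\<close> are \<open>comb A \<sigma>\<close>, \<open>comb b \<sigma>\<close> and \<open>comb c \<sigma>\<close>.\<close>

definition comb :: "('m option \<Rightarrow> 'v::real_vector) \<Rightarrow> real^'m \<Rightarrow> 'v" where
  "comb F \<sigma> = (\<Sum>k\<in>UNIV. weight \<sigma> k *\<^sub>R F k)"

definition Xi ::
    "('m option \<Rightarrow> real^'n^'n) \<Rightarrow> ('m option \<Rightarrow> real^'n) \<Rightarrow> ('m option \<Rightarrow> real) \<Rightarrow>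
     (real^'m \<Rightarrow> ereal) \<Rightarrow> (real^'n) \<times> (real^'m) \<Rightarrow> ereal"
  where "Xi A b c V = (\<lambda>(x, \<sigma>).
     ereal (quad A b c None x + quad_vec A b c x \<bullet> \<sigma>) - conjugate V \<sigma>)"

definition S0 :: "('m option \<Rightarrow> real^'n^'n) \<Rightarrow> (real^'m \<Rightarrow> ereal) \<Rightarrow> (real^'m) set" where
  "S0 A V = {\<sigma> \<in> edom (conjugate V). det (comb A \<sigma>) \<noteq> 0}"

definition S_col ::
    "('m option \<Rightarrow> real^'n^'n) \<Rightarrow> ('m option \<Rightarrow> real^'n) \<Rightarrow> (real^'m \<Rightarrow> ereal) \<Rightarrow> (real^'m) set"
  where "S_col A b V = {\<sigma> \<in> edom (conjugate V). comb b \<sigma> \<in> range (\<lambda>x. comb A \<sigma> *v x)}"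

definition S_col_plus ::
    "('m option \<Rightarrow> real^'n^'n) \<Rightarrow> ('m option \<Rightarrow> real^'n) \<Rightarrow> (real^'m \<Rightarrow> ereal) \<Rightarrow> (real^'m) set"
  where "S_col_plus A b V = {\<sigma> \<in> S_col A b V. pos_semidef (comb A \<sigma>)}"

text \<open>
  The dual function is meaningful on \<open>S_col A b V\<close> only; there the value does not depend on the
  chosen \<open>x\<close>, see \<open>dual_eq\<close> below.
\<close>

definition dual ::
    "('m option \<Rightarrow> real^'n^'n) \<Rightarrow> ('m option \<Rightarrow> real^'n) \<Rightarrow> ('m option \<Rightarrow> real) \<Rightarrow>
     (real^'m \<Rightarrow> ereal) \<Rightarrow> real^'m \<Rightarrow> ereal"
  where "dual A b c V \<sigma> = Xi A b c V (SOME x. comb A \<sigma> *v x = comb b \<sigma>, \<sigma>)"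

lemma sum_option_UNIV:
  fixes F :: "'m::finite option \<Rightarrow> 'v::comm_monoid_add"
  shows "(\<Sum>k\<in>UNIV. F k) = F None + (\<Sum>i\<in>UNIV. F (Some i))"
  by (simp add: UNIV_option_conv sum.reindex)

lemma comb_eq: "comb F \<sigma> = F None + (\<Sum>i\<in>UNIV. \<sigma> $ i *\<^sub>R F (Some i))"
  unfolding comb_def sum_option_UNIV by (simp add: weight_def)

lemma sum_matrix_vector_mult:
  fixes M :: "'i \<Rightarrow> real^'n^'k"
  shows "(\<Sum>i\<in>I. M i) *v x = (\<Sum>i\<in>I. M i *v x)"
  by (induction I rule: infinite_finite_induct) (auto simp: matrix_vector_mult_add_rdistrib)

lemma Xi_eq:
  "Xi A b c V (x, \<sigma>) =
     ereal (1/2 * (x \<bullet> (comb A \<sigma> *v x)) - comb b \<sigma> \<bullet> x + comb c \<sigma>) - conjugate V \<sigma>"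
proof -
  have "quad A b c None x + quad_vec A b c x \<bullet> \<sigma> = (\<Sum>k\<in>UNIV. weight \<sigma> k * quad A b c k x)"
    unfolding sum_option_UNIV
    by (simp add: weight_def quad_vec_def inner_vec_def mult.commute)
  also have "\<dots> = 1/2 * (x \<bullet> (comb A \<sigma> *v x)) - comb b \<sigma> \<bullet> x + comb c \<sigma>"
    by (simp add: comb_def quad_def sum_matrix_vector_mult inner_sum_left inner_sum_right
        scaleR_matrix_vector_assoc[symmetric] algebra_simps sum.distrib sum_subtractf
        sum_distrib_left sum_divide_distrib)
  finally show ?thesis
    by (simp add: Xi_def)
qed

lemma symmetric_matrix_inner:
  assumes "symmetric_matrix M"
  shows "x \<bullet> (M *v y) = (M *v x) \<bullet> y"
  using assms by (metis dot_lmul_matrix symmetric_matrix_def vector_transpose_matrix)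

lemma symmetric_matrix_comb:
  assumes "\<And>k. symmetric_matrix (A k)"
  shows "symmetric_matrix (comb A \<sigma>)"
proof -
  have "A k $ i $ j = A k $ j $ i" for i j k
    using assms[of k] unfolding symmetric_matrix_def transpose_def
    by (metis vec_lambda_beta)
  then show ?thesis
    by (simp add: symmetric_matrix_def transpose_def comb_def vec_eq_iff)
qed

lemma dual_eq:
  assumes "\<And>k. symmetric_matrix (A k)" and x: "comb A \<sigma> *v x = comb b \<sigma>"
  shows "dual A b c V \<sigma> = Xi A b c V (x, \<sigma>)"
proof -
  define y where "y = (SOME x. comb A \<sigma> *v x = comb b \<sigma>)"
  have y: "comb A \<sigma> *v y = comb b \<sigma>"
    unfolding y_def using x by (rule someI)
  have "x \<bullet> comb b \<sigma> = comb b \<sigma> \<bullet> y"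
    using symmetric_matrix_inner[OF symmetric_matrix_comb[of A \<sigma>], of x y] assms(1) x y by simp
  then show ?thesis
    by (simp add: dual_def Xi_eq flip: y_def) (simp add: x y inner_commute)
qed

end

theory Submission
  imports Defs
begin

text \<open>
  Write \<open>L(x, \<sigma>) = q\<^sub>0(x) + \<langle>q(x), \<sigma>\<rangle>\<close>, so that \<open>\<Xi>(x, \<sigma>) = L(x, \<sigma>) - V\<^sup>*(\<sigma>)\<close>. Then
  \<open>(x, \<sigma>)\<close> is critical for \<open>\<Xi>\<close> iff \<open>A(\<sigma>) x = b(\<sigma>)\<close> and \<open>V\<^sup>*\<close> has gradient \<open>q(x)\<close> at \<open>\<sigma>\<close>. If
  \<open>A(\<sigma>)\<close> is invertible, \<open>x = A(\<sigma>)\<^sup>-\<^sup>1 b(\<sigma>)\<close> depends differentiably on \<open>\<sigma>\<close> by Cramer's rule, and as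
  \<open>L\<close> is stationary in \<open>x\<close> the chain rule shows that \<open>\<sigma>\<close> is critical for \<open>D\<close> iff again \<open>V\<^sup>*\<close> has
  gradient \<open>q(x)\<close> at \<open>\<sigma>\<close>. A gradient \<open>v\<close> of \<open>V\<^sup>*\<close> at \<open>\<sigma>\<close> attains the supremum defining \<open>V\<^sup>*(\<sigma>)\<close>, so
  \<open>\<sigma>\<close> is a subgradient of \<open>V\<close> at \<open>v\<close>; essential smoothness forces \<open>v\<close> into the interior of the
  domain, where \<open>\<nabla>V(v) = \<sigma>\<close>. The extremal statements are weak duality,
  \<open>D(\<sigma>) \<le> \<Xi>(x, \<sigma>) \<le> f(x)\<close> when \<open>A(\<sigma>) \<succeq> 0\<close>, together with \<open>f = \<Xi> = D\<close> at the critical point.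
\<close>

section \<open>Gradients at a point\<close>

lemma GDERIV_unique:
  assumes "GDERIV f x :> v" and "GDERIV f x :> w"
  shows "v = w"
proof -
  have "(\<lambda>h. h \<bullet> v) = (\<lambda>h. h \<bullet> w)"
    using has_derivative_unique assms unfolding gderiv_def by blast
  then show ?thesis
    by (metis vector_eq_ldot)
qed

text \<open>This replaces \<open>real_of_ereal\<close> of \<open>f\<close>, \<open>D\<close> or
  \<open>\<Xi>\<close>, near a point where the function is finite, by a real-valued expression to
  which the derivative rules apply.\<close>

lemma GDERIV_cong_eventually:
  assumes "\<forall>\<^sub>F z in nhds x. f z = g z"
  shows "(GDERIV f x :> v) \<longleftrightarrow> (GDERIV g x :> v)"
proof -
  have *: "GDERIV g x :> v" if "GDERIV f x :> v" "\<forall>\<^sub>F z in nhds x. f z = g z" for f g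
    using that unfolding gderiv_def
    by (auto intro!: has_derivative_transform_eventually[where f = f and s = UNIV]
        simp: eventually_nhds_conv_at)
  have "\<forall>\<^sub>F z in nhds x. g z = f z"
    using assms by (rule eventually_mono) simp
  then show ?thesis
    using * assms by blast
qed

lemma isCont_tendsto_nhds: "isCont f x \<Longrightarrow> (f \<longlongrightarrow> f x) (nhds x)"
  by (simp add: isCont_def tendsto_at_iff_tendsto_nhds)

lemma inner_sgn_self: "v \<bullet> sgn v = norm v"
  by (cases "v = 0") (simp_all add: sgn_div_norm dot_square_norm power2_eq_square)

section \<open>Gradients and subgradients of convex functions\<close>

lemma gradient_eqI: "has_gradient_on (edom g) g y v \<Longrightarrow> gradient g y = v"
  unfolding gradient_def has_gradient_on_def by (rule the_equality) (auto intro: GDERIV_unique)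

lemma convex_funD:
  assumes "convex_fun g" "g y \<le> ereal a" "g z \<le> ereal b" "0 \<le> t" "t \<le> 1"
  shows "g ((1 - t) *\<^sub>R y + t *\<^sub>R z) \<le> ereal ((1 - t) * a + t * b)"
  using assms(1)[unfolded convex_fun_def convex_alt, rule_format, of "(y, a)" "(z, b)" t] assms(2-)
  by simp

lemma convex_edom:
  assumes "convex_fun g"
  shows "convex (edom g)"
  unfolding convex_alt
proof (intro ballI allI impI)
  fix y z and t :: real
  assume yz: "y \<in> edom g" "z \<in> edom g" and t: "0 \<le> t \<and> t \<le> 1"
  obtain a b where "g y \<le> ereal a" "g z \<le> ereal b"
    using yz unfolding edom_def by (metis ereal_dense2 less_imp_le mem_Collect_eq)
  then have "g ((1 - t) *\<^sub>R y + t *\<^sub>R z) \<le> ereal ((1 - t) * a + t * b)"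
    using convex_funD[OF assms] t by blast
  then show "(1 - t) *\<^sub>R y + t *\<^sub>R z \<in> edom g"
    unfolding edom_def by (metis ereal_less(1) le_less_trans mem_Collect_eq less_ereal.simps(4))
qed

text \<open>On the segment from \<open>y\<close> to \<open>z\<close>, chord minus function
  (\<open>\<psi>\<close>) is nonnegative and vanishes at the start, so its derivative there,
  \<open>b - a - v \<bullet> (z - y)\<close>, is nonnegative.\<close>

lemma gradient_inequality:
  assumes conv: "convex_fun g" and nm: "\<And>z. g z \<noteq> - \<infinity>" and grad: "has_gradient_on U g y v"
  shows "g y + ereal (v \<bullet> (z - y)) \<le> g z"
proof (cases "g z = \<infinity>")
  case False
  then obtain b where b: "g z = ereal b"
    using nm by (cases "g z") auto
  have ev: "\<forall>\<^sub>F z in nhds y. z \<in> U \<and> \<bar>g z\<bar> \<noteq> \<infinity>"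
    using grad by (simp add: has_gradient_on_def)
  have "\<bar>g y\<bar> \<noteq> \<infinity>"
    using eventually_nhds_x_imp_x[OF ev] by simp
  then obtain a where a: "g y = ereal a"
    by (cases "g y") auto
  define \<phi> where "\<phi> t = real_of_ereal (g (y + t *\<^sub>R (z - y)))" for t :: real
  have "((\<lambda>w. real_of_ereal (g w)) has_derivative (\<lambda>h. h \<bullet> v)) (at (y + 0 *\<^sub>R (z - y)))"
    using grad by (simp add: has_gradient_on_def gderiv_def)
  moreover have "((\<lambda>t. y + t *\<^sub>R (z - y)) has_derivative (\<lambda>h. h *\<^sub>R (z - y))) (at (0::real))"
    by (auto intro!: derivative_eq_intros)
  ultimately have "(\<phi> has_derivative (\<lambda>h. (h *\<^sub>R (z - y)) \<bullet> v)) (at 0)"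
    unfolding \<phi>_def by (rule has_derivative_compose[rotated])
  then have D\<phi>: "(\<phi> has_real_derivative (v \<bullet> (z - y))) (at 0)"
    by (simp add: has_field_derivative_def inner_commute mult.commute[of _ "_ \<bullet> _"] mult_commute_abs)
  define \<psi> where "\<psi> t = (1 - t) * a + t * b - \<phi> t" for t
  have D\<psi>: "(\<psi> has_real_derivative (b - a - v \<bullet> (z - y))) (at 0)"
    unfolding \<psi>_def by (auto intro!: derivative_eq_intros D\<phi>)
  have \<psi>0: "\<psi> 0 = 0"
    by (simp add: \<psi>_def \<phi>_def a)
  have nonneg: "0 \<le> \<psi> t" if "0 \<le> t" "t \<le> 1" for t
  proof -
    have "g (y + t *\<^sub>R (z - y)) \<le> ereal ((1 - t) * a + t * b)"
      using convex_funD[OF conv, of y a z b t] a b that by (simp add: algebra_simps)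
    \<comment> \<open>The real upper bound and \<open>nm\<close> exclude both infinite values, so
      \<open>\<phi> t\<close> is the true value of \<open>g\<close>.\<close>
    then show ?thesis
      using nm[of "y + t *\<^sub>R (z - y)"]
      by (cases "g (y + t *\<^sub>R (z - y))") (auto simp: \<psi>_def \<phi>_def)
  qed
  have "0 \<le> b - a - v \<bullet> (z - y)"
  proof (rule ccontr)
    assume "\<not> ?thesis"
    then obtain d where d: "d > 0" "\<And>h. 0 < h \<Longrightarrow> h < d \<Longrightarrow> \<psi> (0 + h) < \<psi> 0"
      using DERIV_neg_dec_right[OF D\<psi>] by force
    define t where "t = min (d / 2) 1"
    have "0 < t" "t < d" "t \<le> 1"
      using d(1) by (auto simp: t_def)
    then show False
      using d(2)[of t] nonneg[of t] \<psi>0 by simp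
  qed
  then show ?thesis
    by (simp add: a b)
qed simp

text \<open>
  If a subgradient \<open>s\<close> existed at a boundary point \<open>y\<close>, then along the segment from an interior
  point \<open>y0\<close> to \<open>y\<close> the gradients would stay bounded: \<open>g\<close> is bounded above on a ball around \<open>y0\<close>
  and below on the segment, and monotonicity bounds the slope in the direction \<open>y0 - y\<close> from below.
\<close>

lemma essentially_smooth_subgradient_interior:
  assumes conv: "convex_fun g" and nm: "\<And>z. g z \<noteq> - \<infinity>" and es: "essentially_smooth g"
    and s: "s \<in> subdifferential g y"
  shows "y \<in> interior (edom g)"
proof (rule ccontr)
  assume y: "y \<notin> interior (edom g)"
  obtain a where a: "g y = ereal a"
    using s by (auto simp: subdifferential_def)
  have sub: "ereal (a + s \<bullet> (z - y)) \<le> g z" for z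
    using s a by (auto simp: subdifferential_def)
  obtain y0 where y0: "y0 \<in> interior (edom g)"
    using es by (auto simp: essentially_smooth_def)
  have grad: "has_gradient_on (edom g) g z (gradient g z)" if "z \<in> interior (edom g)" for z
    using es that gradient_eqI unfolding essentially_smooth_def by metis
  \<comment> \<open>The sequence starts at \<open>y0\<close> and moves along the segment towards
    \<open>y\<close>; since \<open>y\<close> is in the domain, all its points are interior.\<close>
  define Y where "Y k = y + inverse (real (Suc k)) *\<^sub>R (y0 - y)" for k
  have Y_int: "Y k \<in> interior (edom g)" for k
  proof -
    have "y - inverse (real (Suc k)) *\<^sub>R (y - y0) \<in> interior (edom g)"
      using a by (intro mem_interior_convex_shrink convex_edom conv y0)
        (auto simp: edom_def divide_simps)
    then show ?thesis
      by (simp add: Y_def algebra_simps)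
  qed
  have "(\<lambda>k. y + inverse (real (Suc k)) *\<^sub>R (y0 - y)) \<longlonglongrightarrow> y + 0 *\<^sub>R (y0 - y)"
    by (intro tendsto_intros LIMSEQ_inverse_real_of_nat)
  then have Y_lim: "Y \<longlonglongrightarrow> y"
    by (simp add: Y_def[abs_def])
  have "y \<in> closure (interior (edom g))"
    using Y_int Y_lim closure_sequential by blast
  then have "y \<in> frontier (interior (edom g))"
    using y by (simp add: frontier_def)
  then have unbounded: "filterlim (\<lambda>k. norm (gradient g (Y k))) at_top sequentially"
    using es Y_int Y_lim unfolding essentially_smooth_def by blast
  have "isCont (\<lambda>z. real_of_ereal (g z)) y0"
    using grad[OF y0] unfolding has_gradient_on_def gderiv_def by (blast intro: has_derivative_continuous)
  then have "\<forall>\<^sub>F z in nhds y0. real_of_ereal (g z) < real_of_ereal (g y0) + 1"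
    by (intro order_tendstoD(2)[OF isCont_tendsto_nhds]) auto
  moreover have "\<forall>\<^sub>F z in nhds y0. \<bar>g z\<bar> \<noteq> \<infinity>"
    using grad[OF y0] unfolding has_gradient_on_def by (simp add: eventually_conj_iff)
  ultimately have "\<forall>\<^sub>F z in nhds y0. g z \<le> ereal (real_of_ereal (g y0) + 1)"
    by eventually_elim (metis ereal_less_eq(3) ereal_real less_imp_le)
  then obtain r M where r: "r > 0" and M: "\<And>z. dist z y0 < r \<Longrightarrow> g z \<le> ereal M"
    unfolding eventually_nhds_metric by blast
  \<comment> \<open>\<open>K\<close> bounds \<open>M - a - s \<bullet> (y0 - y)\<close> by
    Cauchy-Schwarz and does not depend on \<open>k\<close>.\<close>
  define K where "K = M - a + norm s * norm (y0 - y)"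
  have bound: "norm (gradient g (Y k)) \<le> 2 * K / r" for k
  proof -
    define t where "t = inverse (real (Suc k))"
    have t: "0 < t" "t \<le> 1"
      by (auto simp: t_def divide_simps)
    define v where "v = gradient g (Y k)"
    have Yk: "Y k = y + t *\<^sub>R (y0 - y)"
      by (simp add: Y_def t_def)
    have gi: "g (Y k) + ereal (v \<bullet> (z - Y k)) \<le> g z" for z
      unfolding v_def by (rule gradient_inequality[OF conv nm grad[OF Y_int]])
    obtain e where e: "g (Y k) = ereal e"
      using Y_int[of k] nm[of "Y k"] interior_subset by (cases "g (Y k)") (auto simp: edom_def)
    have e_ge: "a + t * (s \<bullet> (y0 - y)) \<le> e"
      using sub[of "Y k"] unfolding e by (simp add: Yk)
    \<comment> \<open>Monotonicity: the gradient inequality from \<open>Y k\<close> to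
      \<open>y\<close> is combined with the subgradient inequality from \<open>y\<close> to
      \<open>Y k\<close>.\<close>
    have "e + v \<bullet> (y - Y k) \<le> a"
      using gi[of y] by (simp add: e a)
    then have "e - t * (v \<bullet> (y0 - y)) \<le> a"
      by (simp add: Yk)
    then have "t * (s \<bullet> (y0 - y)) \<le> t * (v \<bullet> (y0 - y))"
      using e_ge by linarith
    then have slope: "s \<bullet> (y0 - y) \<le> v \<bullet> (y0 - y)"
      using t(1) by simp
    \<comment> \<open>A step along \<open>v\<close> that stays in the ball where
      \<open>g \<le> M\<close>; it turns \<open>v \<bullet> u\<close> into a multiple of
      \<open>norm v\<close>, also when \<open>v = 0\<close>.\<close>
    define u where "u = (r / 2) *\<^sub>R sgn v"
    have "norm u < r"
      using r by (simp add: u_def norm_sgn)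
    then have "g (y0 + u) \<le> ereal M"
      by (intro M) (simp add: dist_norm)
    with gi[of "y0 + u"] have "e + v \<bullet> (y0 + u - Y k) \<le> M"
      by (auto simp: e dest: order_trans)
    moreover have "v \<bullet> (y0 + u - Y k) = (1 - t) * (v \<bullet> (y0 - y)) + (r / 2) * norm v"
    proof -
      have "v \<bullet> u = (r / 2) * norm v"
        by (simp add: u_def inner_sgn_self)
      moreover have "y0 + u - Y k = (1 - t) *\<^sub>R (y0 - y) + u"
        by (simp add: Yk algebra_simps)
      ultimately show ?thesis
        by (simp only: inner_add_right inner_scaleR_right)
    qed
    \<comment> \<open>Together with \<open>e_ge\<close> the weights \<open>t\<close> and
      \<open>1 - t\<close> add up to 1, so the final bound is free of \<open>t\<close>.\<close>
    moreover have "(1 - t) * (s \<bullet> (y0 - y)) \<le> (1 - t) * (v \<bullet> (y0 - y))"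
      using slope t by (intro mult_left_mono) auto
    ultimately have "(r / 2) * norm v \<le> M - a - s \<bullet> (y0 - y)"
      using e_ge by (simp add: algebra_simps)
    also have "\<dots> \<le> K"
      using Cauchy_Schwarz_ineq2[of s "y0 - y"] unfolding K_def by linarith
    finally show ?thesis
      using r by (simp add: v_def field_simps)
  qed
  have "\<forall>\<^sub>F k in sequentially. 2 * K / r < norm (gradient g (Y k))"
    using unbounded by (simp add: filterlim_at_top_dense)
  then have "\<exists>k. 2 * K / r < norm (gradient g (Y k))"
    by (rule eventually_happens'[OF sequentially_bot])
  then show False
    using bound leD by blast
qed

text \<open>The point is interior, so some gradient \<open>v\<close> exists there; \<open>g\<close>
  minus the linear form of \<open>s\<close> has a local minimum at \<open>y\<close>, which forces
  \<open>v = s\<close>.\<close>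

lemma essentially_smooth_subgradient_gradient:
  assumes conv: "convex_fun g" and nm: "\<And>z. g z \<noteq> - \<infinity>" and es: "essentially_smooth g"
    and s: "s \<in> subdifferential g y"
  shows "has_gradient_on (edom g) g y s"
proof -
  have "\<forall>z\<in>interior (edom g). \<exists>v. has_gradient_on (edom g) g z v"
    using es by (simp add: essentially_smooth_def)
  then obtain v where v: "has_gradient_on (edom g) g y v"
    using essentially_smooth_subgradient_interior[OF assms] by blast
  then have "\<forall>\<^sub>F z in nhds y. \<bar>g z\<bar> \<noteq> \<infinity>"
    by (simp add: has_gradient_on_def eventually_conj_iff)
  then obtain U where U: "open U" "y \<in> U" and fin: "\<And>z. z \<in> U \<Longrightarrow> \<bar>g z\<bar> \<noteq> \<infinity>"
    unfolding eventually_nhds by auto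
  define \<phi> where "\<phi> z = real_of_ereal (g z) - z \<bullet> s" for z
  have "\<phi> y \<le> \<phi> z" if "z \<in> U" for z
  proof -
    have "g y + ereal (s \<bullet> (z - y)) \<le> g z"
      using s by (simp add: subdifferential_def)
    then show ?thesis
      using fin[OF that] fin[OF U(2)]
      by (cases "g z"; cases "g y") (auto simp: \<phi>_def inner_diff_right inner_commute)
  qed
  moreover have "(\<phi> has_derivative (\<lambda>h. h \<bullet> v - h \<bullet> s)) (at y)"
    using v unfolding \<phi>_def has_gradient_on_def gderiv_def by (auto intro!: derivative_eq_intros)
  ultimately have "(\<lambda>h. h \<bullet> v - h \<bullet> s) = (\<lambda>h. 0)"
    by (intro differential_zero_maxmin[OF U(2,1)]) auto
  from fun_cong[OF this] have "\<forall>h. h \<bullet> v = h \<bullet> s"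
    by simp
  then have "v = s"
    by (simp add: vector_eq_ldot)
  then show ?thesis
    using v by simp
qed

section \<open>Fenchel conjugates and their gradients\<close>

lemma Fenchel_Young: "ereal (y \<bullet> s) - g y \<le> conjugate g s"
  unfolding conjugate_def by (rule SUP_upper) simp

lemma conjugate_not_minus_infinity:
  assumes "proper g"
  shows "conjugate g s \<noteq> - \<infinity>"
proof -
  obtain y where "g y < \<infinity>"
    using assms by (auto simp: proper_def edom_def)
  then show ?thesis
    using Fenchel_Young[of y s g] by (cases "g y") auto
qed

text \<open>
  Points \<open>y\<close> that nearly attain the supremum defining \<open>conjugate g s\<close> are approximate subgradients
  of the conjugate at \<open>s\<close>, hence close to its gradient \<open>v\<close>; lower semicontinuity at \<open>v\<close> does the rest.
\<close>

lemma conjugate_gradient_attains: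
  assumes lsc: "lsc g" and prp: "proper g"
    and grad: "GDERIV (\<lambda>z. real_of_ereal (conjugate g z)) s :> v"
    and dom: "s \<in> interior (edom (conjugate g))"
  shows "g v = ereal (v \<bullet> s - real_of_ereal (conjugate g s))"
proof -
  define w where "w z = real_of_ereal (conjugate g z)" for z
  have w: "conjugate g z = ereal (w z)" if "z \<in> edom (conjugate g)" for z
    using that conjugate_not_minus_infinity[OF prp, of z]
    by (cases "conjugate g z") (auto simp: w_def edom_def)
  have ws: "conjugate g s = ereal (w s)"
    using dom interior_subset w by blast
  have lower: "ereal (v \<bullet> s - w s) \<le> g v"
    using Fenchel_Young[of v s g] by (cases "g v") (auto simp: ws)
  show ?thesis
  proof (rule ccontr)
    assume "\<not> ?thesis"
    then have "ereal (v \<bullet> s - w s) < g v"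
      using lower unfolding w_def by simp
    then obtain c where "ereal (v \<bullet> s - w s) < ereal c" and c: "ereal c < g v"
      using ereal_dense2 by blast
    \<comment> \<open>With \<open>c1\<close> inside the gap, every \<open>y\<close> near
      \<open>v\<close> has \<open>y \<bullet> s - g y\<close> below \<open>w s\<close> by at least
      \<open>c - c1\<close>.\<close>
    define c1 where "c1 = (v \<bullet> s - w s + c) / 2"
    have c1: "v \<bullet> s - w s < c1" "c1 < c"
      using \<open>ereal (v \<bullet> s - w s) < ereal c\<close> by (auto simp: c1_def)
    have "\<forall>\<^sub>F y in at v. ereal c < g y"
      using lsc c unfolding lsc_def le_Liminf_iff by blast
    then have ev1: "\<forall>\<^sub>F y in nhds v. ereal c < g y"
      using c by (simp add: eventually_nhds_conv_at)
    have "((\<lambda>y. y \<bullet> s - w s) \<longlongrightarrow> v \<bullet> s - w s) (nhds v)"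
      by (intro tendsto_intros filterlim_ident)
    then have ev2: "\<forall>\<^sub>F y in nhds v. y \<bullet> s - w s < c1"
      using c1(1) by (rule order_tendstoD)
    obtain \<rho> where \<rho>: "\<rho> > 0" "\<And>y. dist y v < \<rho> \<Longrightarrow> ereal c < g y \<and> y \<bullet> s - w s < c1"
      using eventually_conj[OF ev1 ev2] unfolding eventually_nhds_metric by blast
    \<comment> \<open>Away from \<open>v\<close> a step in a suitable direction gains at least
      \<open>\<rho>\<close> per unit length, so an error of \<open>\<rho> / 3\<close> leaves room to
      spare.\<close>
    obtain d1 where d1: "d1 > 0" "\<And>z. norm (z - s) < d1 \<Longrightarrow>
        norm (w z - w s - (z - s) \<bullet> v) \<le> (\<rho> / 3) * norm (z - s)"
      using grad[unfolded gderiv_def has_derivative_at_alt, folded w_def, THEN conjunct2, rule_format, of "\<rho> / 3"]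
        \<rho>(1) by auto
    obtain d2 where d2: "d2 > 0" "ball s d2 \<subseteq> edom (conjugate g)"
      using dom mem_interior by blast
    define \<delta> where "\<delta> = min d1 d2 / 2"
    have \<delta>: "\<delta> > 0" "\<delta> < d1" "\<delta> < d2"
      using d1(1) d2(1) by (auto simp: \<delta>_def)
    \<comment> \<open>The first entry is the shortfall for \<open>y\<close> near \<open>v\<close>,
      the second the one for \<open>y\<close> away from \<open>v\<close>. Together they lower the
      supremum, a contradiction.\<close>
    define \<epsilon> where "\<epsilon> = min (c - c1) (\<delta> * \<rho> / 3)"
    have \<epsilon>: "\<epsilon> > 0"
      using c1(2) \<delta>(1) \<rho>(1) by (simp add: \<epsilon>_def)
    have "ereal (y \<bullet> s) - g y \<le> ereal (w s - \<epsilon>)" for y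
    proof (cases "g y")
      case (real e)
      show ?thesis
      proof (cases "dist y v < \<rho>")
        case True
        then have "c < e" "y \<bullet> s - w s < c1"
          using \<rho>(2)[OF True] real by auto
        then show ?thesis
          by (simp add: real \<epsilon>_def)
      next
        case False
        \<comment> \<open>Fenchel-Young is tested at \<open>s + u\<close>, with \<open>u\<close>
          pointing from \<open>v\<close> to \<open>y\<close>, so that
          \<open>(y - v) \<bullet> u\<close> is at least \<open>\<delta> * \<rho>\<close>.\<close>
        define u where "u = \<delta> *\<^sub>R sgn (y - v)"
        have "y \<noteq> v"
          using False \<rho>(1) by auto
        then have nu: "norm u = \<delta>"
          using \<delta>(1) by (simp add: u_def norm_sgn)
        have "s + u \<in> edom (conjugate g)"
          using d2(2) nu \<delta>(3) by (auto simp: dist_norm)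
        then have "y \<bullet> (s + u) - e \<le> w (s + u)"
          using Fenchel_Young[of y "s + u" g] w real by simp
        moreover have "\<bar>w (s + u) - w s - u \<bullet> v\<bar> \<le> (\<rho> / 3) * \<delta>"
          using d1(2)[of "s + u"] nu \<delta>(2) by simp
        ultimately have "y \<bullet> s - e \<le> w s + (\<rho> / 3) * \<delta> - (y - v) \<bullet> u"
          unfolding inner_diff_left inner_add_right inner_commute[of u] by linarith
        also have "(y - v) \<bullet> u = \<delta> * norm (y - v)"
          by (simp add: u_def inner_sgn_self)
        also have "w s + (\<rho> / 3) * \<delta> - \<delta> * norm (y - v) \<le> w s + (\<rho> / 3) * \<delta> - \<delta> * \<rho>"
          by (rule diff_left_mono, rule mult_left_mono) (use False \<delta>(1) in \<open>auto simp: dist_norm\<close>)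
        also have "\<dots> \<le> w s - \<delta> * \<rho> / 3"
          using \<delta>(1) \<rho>(1) by (simp add: field_simps)
        also have "\<dots> \<le> w s - \<epsilon>"
          unfolding \<epsilon>_def by (intro diff_left_mono min.cobounded2)
        finally show ?thesis
          by (simp add: real)
      qed
    qed (use prp in \<open>auto simp: proper_def\<close>)
    then have "conjugate g s \<le> ereal (w s - \<epsilon>)"
      unfolding conjugate_def by (rule SUP_least)
    then show False
      using ws \<epsilon> by simp
  qed
qed

text \<open>Given equality in Fenchel-Young at \<open>v\<close>, the inequality at any other
  \<open>z\<close> rearranges to the subgradient inequality.\<close>

lemma conjugate_gradient_subgradient:
  assumes lsc: "lsc g" and prp: "proper g"
    and grad: "GDERIV (\<lambda>z. real_of_ereal (conjugate g z)) s :> v"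
    and dom: "s \<in> interior (edom (conjugate g))"
  shows "s \<in> subdifferential g v"
proof -
  have gv: "g v = ereal (v \<bullet> s - real_of_ereal (conjugate g s))"
    by (rule conjugate_gradient_attains[OF assms])
  obtain a where a: "conjugate g s = ereal a"
    using dom interior_subset conjugate_not_minus_infinity[OF prp, of s]
    by (cases "conjugate g s") (auto simp: edom_def)
  have "g v + ereal (s \<bullet> (z - v)) \<le> g z" for z
    using Fenchel_Young[of z s g] unfolding gv a
    by (cases "g z") (auto simp: inner_diff_right inner_commute)
  then show ?thesis
    by (simp add: subdifferential_def gv)
qed

section \<open>Derivatives of vector-valued maps, differences and maps on products\<close>

lemma has_derivative_vecI:
  fixes f :: "'a::real_normed_vector \<Rightarrow> real^'n"
  assumes "\<And>i. ((\<lambda>x. f x $ i) has_derivative (\<lambda>h. f' h $ i)) (at x)"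
  shows "(f has_derivative f') (at x)"
  unfolding has_derivative_componentwise_within[of f f' x UNIV] using assms
  by (auto simp: Basis_vec_def inner_axis)

text \<open>From left to right, \<open>g\<close> is recovered as \<open>f\<close> minus the
  difference, so criticality of \<open>\<Xi>\<close> or \<open>D\<close> also yields
  differentiability of the conjugate.\<close>

lemma GDERIV_diff_zero_iff:
  assumes "GDERIV f x :> v"
  shows "(GDERIV (\<lambda>z. f z - g z) x :> 0) \<longleftrightarrow> (GDERIV g x :> v)"
  using GDERIV_diff[OF assms, of "\<lambda>z. f z - g z" 0] GDERIV_diff[OF assms, of g v] by auto

text \<open>Restriction to the two slices through \<open>(x, s)\<close> separates the components;
  the first slice is constant.\<close>

lemma GDERIV_comp_snd_iff:
  "(GDERIV (\<lambda>z. g (snd z)) (x, s) :> (u, v)) \<longleftrightarrow> u = 0 \<and> (GDERIV g s :> v)"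
proof
  assume "GDERIV (\<lambda>z. g (snd z)) (x, s) :> (u, v)"
  then have d: "((\<lambda>z. g (snd z)) has_derivative (\<lambda>h. h \<bullet> (u, v))) (at (x, s))"
    by (simp add: gderiv_def)
  have "((\<lambda>y. g (snd (y, s))) has_derivative (\<lambda>h. (h, 0) \<bullet> (u, v))) (at x)"
    by (rule has_derivative_compose[where f = "\<lambda>y. (y, s)", OF _ d]) (auto intro!: derivative_eq_intros)
  then have "GDERIV (\<lambda>y. g s) x :> u"
    by (simp add: gderiv_def)
  then have "u = 0"
    using GDERIV_unique GDERIV_const by blast
  moreover have "((\<lambda>\<sigma>. g (snd (x, \<sigma>))) has_derivative (\<lambda>h. (0, h) \<bullet> (u, v))) (at s)"
    by (rule has_derivative_compose[where f = "\<lambda>\<sigma>. (x, \<sigma>)", OF _ d]) (auto intro!: derivative_eq_intros)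
  ultimately show "u = 0 \<and> (GDERIV g s :> v)"
    by (simp add: gderiv_def)
next
  assume "u = 0 \<and> (GDERIV g s :> v)"
  then have d: "(g has_derivative (\<lambda>h. h \<bullet> v)) (at (snd (x, s)))" and u: "u = 0"
    by (simp_all add: gderiv_def)
  have "((\<lambda>z. g (snd z)) has_derivative (\<lambda>h. snd h \<bullet> v)) (at (x, s))"
    by (rule has_derivative_compose[where f = snd, OF _ d]) (auto intro!: derivative_eq_intros)
  then show "GDERIV (\<lambda>z. g (snd z)) (x, s) :> (u, v)"
    by (simp add: gderiv_def u inner_prod_def)
qed

section \<open>The Lagrangian and the critical points of \<open>\<Xi>\<close>\<close>

definition lagrangian ::
    "('m option \<Rightarrow> real^'n^'n) \<Rightarrow> ('m option \<Rightarrow> real^'n) \<Rightarrow> ('m option \<Rightarrow> real) \<Rightarrow>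
     real^'n \<Rightarrow> real^'m \<Rightarrow> real"
  where "lagrangian A b c x s = quad A b c None x + quad_vec A b c x \<bullet> s"

lemma lagrangian_eq:
  "lagrangian A b c x s = 1/2 * (x \<bullet> (comb A s *v x)) - comb b s \<bullet> x + comb c s"
proof -
  \<comment> \<open>The indicator of \<open>{0}\<close> has conjugate \<open>0\<close>, which turns \<open>Xi\<close> into the Lagrangian.\<close>
  let ?I = "\<lambda>y. if y = 0 then 0 else \<infinity> :: ereal"
  have "conjugate ?I s = 0"
    unfolding conjugate_def
    by (rule antisym) (auto intro!: SUP_least SUP_upper2[where i = 0])
  then show ?thesis
    using Xi_eq[of A b c ?I x s] by (simp add: Xi_def lagrangian_def)
qed

lemma quad_has_derivative:
  assumes "symmetric_matrix (A k)"
  shows "(quad A b c k has_derivative (\<lambda>h. h \<bullet> (A k *v x - b k))) (at x)"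
proof -
  have M: "((\<lambda>x. A k *v x) has_derivative (\<lambda>h. A k *v h)) (at x)"
    by (intro bounded_linear.has_derivative[OF matrix_vector_mul_bounded_linear] has_derivative_ident)
  have "((\<lambda>x. 1/2 * (x \<bullet> (A k *v x)) - b k \<bullet> x + c k) has_derivative
      (\<lambda>h. 1/2 * (x \<bullet> (A k *v h) + h \<bullet> (A k *v x)) - b k \<bullet> h)) (at x)"
    by (auto intro!: derivative_eq_intros M)
  \<comment> \<open>Symmetry makes the two bilinear terms equal, which cancels the factor
    1/2.\<close>
  moreover have "1/2 * (x \<bullet> (A k *v h) + h \<bullet> (A k *v x)) - b k \<bullet> h = h \<bullet> (A k *v x - b k)" for h
    using symmetric_matrix_inner[OF assms, of x h] by (simp add: inner_diff_right inner_commute)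
  ultimately show ?thesis
    by (simp add: quad_def[abs_def])
qed

lemma quad_vec_has_derivative:
  assumes "\<And>k. symmetric_matrix (A k)"
  shows "(quad_vec A b c has_derivative (\<lambda>h. \<chi> i. h \<bullet> (A (Some i) *v x - b (Some i)))) (at x)"
  using quad_has_derivative[where A = A, OF assms]
  by (intro has_derivative_vecI) (simp add: quad_vec_def)

text \<open>The left side is the derivative of the Lagrangian in \<open>x\<close> along
  \<open>h\<close>, so stationarity in \<open>x\<close> is the linear system
  \<open>A(s) x = b(s)\<close>.\<close>

lemma inner_comb_residual:
  fixes A :: "'m::finite option \<Rightarrow> real^'n^'n"
  shows "h \<bullet> (A None *v x - b None) + (\<chi> i. h \<bullet> (A (Some i) *v x - b (Some i))) \<bullet> s =
   h \<bullet> (comb A s *v x - comb b s)"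
proof -
  have "comb A s *v x = A None *v x + (\<Sum>i\<in>UNIV. s $ i *\<^sub>R (A (Some i) *v x))"
    by (simp add: comb_eq matrix_vector_mult_add_rdistrib sum_matrix_vector_mult
        scaleR_matrix_vector_assoc)
  then show ?thesis
    by (simp add: comb_eq[of b] inner_vec_def[of "vec_lambda _"] inner_sum_right algebra_simps
        sum_subtractf)
qed

lemma lagrangian_GDERIV:
  assumes "\<And>k. symmetric_matrix (A k)"
  shows "GDERIV (\<lambda>z. lagrangian A b c (fst z) (snd z)) (x, s) :>
    (comb A s *v x - comb b s, quad_vec A b c x)"
proof -
  let ?q' = "\<lambda>h. \<chi> i. h \<bullet> (A (Some i) *v x - b (Some i))"
  have "(quad A b c None has_derivative (\<lambda>h. h \<bullet> (A None *v x - b None))) (at (fst (x, s)))"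
    using quad_has_derivative[where A = A, OF assms] by simp
  from has_derivative_compose[where f = fst, OF has_derivative_fst[OF has_derivative_ident] this]
  have q0: "((\<lambda>z. quad A b c None (fst z)) has_derivative
      (\<lambda>h. fst h \<bullet> (A None *v x - b None))) (at (x, s))" .
  have "(quad_vec A b c has_derivative ?q') (at (fst (x, s)))"
    using quad_vec_has_derivative[where A = A, OF assms] by simp
  from has_derivative_compose[where f = fst, OF has_derivative_fst[OF has_derivative_ident] this]
  have q: "((\<lambda>z. quad_vec A b c (fst z)) has_derivative (\<lambda>h. ?q' (fst h))) (at (x, s))" .
  have "((\<lambda>z. quad A b c None (fst z) + quad_vec A b c (fst z) \<bullet> snd z) has_derivative
      (\<lambda>h. fst h \<bullet> (A None *v x - b None) + (quad_vec A b c x \<bullet> snd h + ?q' (fst h) \<bullet> s))) (at (x, s))"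
    by (auto intro!: derivative_eq_intros q0 q)
  then show ?thesis
    unfolding gderiv_def lagrangian_def
    by (rule has_derivative_eq_rhs)
      (auto simp: inner_prod_def inner_comb_residual[symmetric] inner_commute)
qed

lemma Xi_eq_lagrangian:
  assumes "proper V" "s \<in> edom (conjugate V)"
  shows "Xi A b c V (x, s) = ereal (lagrangian A b c x s - real_of_ereal (conjugate V s))"
  using assms conjugate_not_minus_infinity[of V s]
  by (cases "conjugate V s") (auto simp: Xi_def lagrangian_def edom_def)

text \<open>\<open>\<Xi>\<close> is finite on an open neighbourhood, so only the zero gradient
  remains; it says that the conjugate, as a function of the pair, has the gradient of the
  Lagrangian.\<close>

lemma Xi_critical_iff:
  fixes x :: "real^'n" and s :: "real^'m"
  assumes sym: "\<And>k. symmetric_matrix (A k)" and V: "proper V"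
    and s: "s \<in> interior (edom (conjugate V))"
  shows "critical_point_on (UNIV \<times> interior (edom (conjugate V))) (Xi A b c V) (x, s) \<longleftrightarrow>
    comb A s *v x = comb b s \<and> (GDERIV (\<lambda>\<sigma>. real_of_ereal (conjugate V \<sigma>)) s :> quad_vec A b c x)"
proof -
  let ?Z = "(UNIV :: (real^'n) set) \<times> interior (edom (conjugate V))"
  have "open ?Z" "(x, s) \<in> ?Z"
    using s by (auto intro: open_Times)
  then have evZ: "\<forall>\<^sub>F z in nhds (x, s). z \<in> ?Z"
    by (rule eventually_nhds_in_open)
  have Xi: "Xi A b c V z =
      ereal (lagrangian A b c (fst z) (snd z) - real_of_ereal (conjugate V (snd z)))" if "z \<in> ?Z" for z
    using that Xi_eq_lagrangian[OF V, of "snd z" A b c "fst z"] interior_subset by fastforce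
  have "critical_point_on ?Z (Xi A b c V) (x, s) \<longleftrightarrow>
      (GDERIV (\<lambda>z. real_of_ereal (Xi A b c V z)) (x, s) :> 0)"
    unfolding critical_point_on_def has_gradient_on_def
    using eventually_mono[OF evZ, of "\<lambda>z. z \<in> ?Z \<and> \<bar>Xi A b c V z\<bar> \<noteq> \<infinity>"] Xi by force
  also have "\<dots> \<longleftrightarrow> (GDERIV (\<lambda>z. lagrangian A b c (fst z) (snd z) -
      real_of_ereal (conjugate V (snd z))) (x, s) :> 0)"
    by (rule GDERIV_cong_eventually, rule eventually_mono[OF evZ]) (simp add: Xi)
  also have "\<dots> \<longleftrightarrow> (GDERIV (\<lambda>z. real_of_ereal (conjugate V (snd z))) (x, s) :>
      (comb A s *v x - comb b s, quad_vec A b c x))"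
    by (rule GDERIV_diff_zero_iff[OF lagrangian_GDERIV[where A = A, OF sym]])
  finally show ?thesis
    by (simp add: GDERIV_comp_snd_iff[of "\<lambda>\<sigma>. real_of_ereal (conjugate V \<sigma>)"])
qed

section \<open>Critical points of the dual and primal functions\<close>

lemma comb_has_derivative:
  fixes F :: "'m::finite option \<Rightarrow> 'v::real_normed_vector"
  shows "(comb F has_derivative (\<lambda>h. \<Sum>i\<in>UNIV. h $ i *\<^sub>R F (Some i))) (at s)"
proof -
  have nth: "((\<lambda>\<sigma>. \<sigma> $ i) has_derivative (\<lambda>h. h $ i)) (at s)" for i :: 'm
    by (intro bounded_linear.has_derivative[OF bounded_linear_vec_nth] has_derivative_ident)
  have "((\<lambda>\<sigma>. F None + (\<Sum>i\<in>UNIV. \<sigma> $ i *\<^sub>R F (Some i))) has_derivative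
      (\<lambda>h. \<Sum>i\<in>UNIV. h $ i *\<^sub>R F (Some i))) (at s)"
    by (auto intro!: derivative_eq_intros nth)
  then show ?thesis
    by (simp add: comb_eq[abs_def])
qed

text \<open>By the Leibniz formula the determinant is a polynomial in the entries.\<close>

lemma det_differentiable:
  fixes M :: "'a::real_normed_vector \<Rightarrow> real^'n^'n"
  assumes "\<And>i j. (\<lambda>\<sigma>. M \<sigma> $ i $ j) differentiable (at s)"
  shows "(\<lambda>\<sigma>. det (M \<sigma>)) differentiable (at s)"
proof -
  have "((\<lambda>\<sigma>. M \<sigma> $ i $ j) has_derivative frechet_derivative (\<lambda>\<sigma>. M \<sigma> $ i $ j) (at s)) (at s)" for i j
    using assms frechet_derivative_works by blast
  note [derivative_intros] = this
  show ?thesis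
    unfolding differentiable_def det_def by (rule exI) (rule derivative_intros)+
qed

lemma comb_solution_differentiable:
  fixes A :: "'m::finite option \<Rightarrow> real^'n^'n" and b :: "'m option \<Rightarrow> real^'n"
  assumes det: "det (comb A s) \<noteq> 0"
  obtains h h' where "(h has_derivative h') (at s)"
    and "\<forall>\<^sub>F \<sigma> in nhds s. comb A \<sigma> *v h \<sigma> = comb b \<sigma>"
proof -
  \<comment> \<open>Cramer's quotients. They solve the system where the determinant is nonzero,
    which by continuity includes a neighbourhood of \<open>s\<close>.\<close>
  define h where
    "h \<sigma> = (\<chi> k. det (\<chi> i j. if j = k then comb b \<sigma> $ i else comb A \<sigma> $ i $ j) / det (comb A \<sigma>))" for \<sigma>
  have b': "(\<lambda>\<sigma>. comb b \<sigma> $ i) differentiable (at s)" for i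
    unfolding differentiable_def
    by (rule exI) (rule bounded_linear.has_derivative[OF bounded_linear_vec_nth comb_has_derivative])
  have A': "(\<lambda>\<sigma>. comb A \<sigma> $ i $ j) differentiable (at s)" for i j
    unfolding differentiable_def
    by (rule exI) (rule bounded_linear.has_derivative[OF bounded_linear_vec_nth
          bounded_linear.has_derivative[OF bounded_linear_vec_nth comb_has_derivative]])
  have detA: "(\<lambda>\<sigma>. det (comb A \<sigma>)) differentiable (at s)"
    by (rule det_differentiable) (rule A')
  have "(\<lambda>\<sigma>. det (\<chi> i j. if j = k then comb b \<sigma> $ i else comb A \<sigma> $ i $ j)) differentiable (at s)"
    for k
  proof (rule det_differentiable)
    fix i j
    show "(\<lambda>\<sigma>. (\<chi> i j. if j = k then comb b \<sigma> $ i else comb A \<sigma> $ i $ j) $ i $ j) differentiable (at s)"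
      by (cases "j = k") (simp_all add: A' b')
  qed
  then have "(\<lambda>\<sigma>. h \<sigma> $ k) differentiable (at s)" for k
    unfolding h_def using detA det by (simp add: differentiable_divide)
  then have "((\<lambda>\<sigma>. h \<sigma> $ k) has_derivative frechet_derivative (\<lambda>\<sigma>. h \<sigma> $ k) (at s)) (at s)" for k
    using frechet_derivative_works by blast
  then have "(h has_derivative (\<lambda>d. \<chi> k. frechet_derivative (\<lambda>\<sigma>. h \<sigma> $ k) (at s) d)) (at s)"
    by (intro has_derivative_vecI) simp
  moreover have "isCont (\<lambda>\<sigma>. det (comb A \<sigma>)) s"
    using detA by (rule differentiable_imp_continuous_within)
  then have "\<forall>\<^sub>F \<sigma> in nhds s. det (comb A \<sigma>) \<noteq> 0"
    using det by (intro tendsto_imp_eventually_ne[OF isCont_tendsto_nhds]) auto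
  then have "\<forall>\<^sub>F \<sigma> in nhds s. comb A \<sigma> *v h \<sigma> = comb b \<sigma>"
    by (rule eventually_mono) (simp add: cramer h_def)
  ultimately show ?thesis
    by (rule that)
qed

text \<open>Envelope argument: near \<open>s\<close> the dual is the Lagrangian along the solution
  curve \<open>h\<close> minus the conjugate.\<close>

lemma dual_critical_iff:
  fixes A :: "'m::finite option \<Rightarrow> real^'n^'n"
  assumes sym: "\<And>k. symmetric_matrix (A k)" and V: "proper V"
    and s: "s \<in> interior (edom (conjugate V))"
    and det: "det (comb A s) \<noteq> 0" and x: "comb A s *v x = comb b s"
  shows "critical_point_on (S_col A b V) (dual A b c V) s \<longleftrightarrow>
    (GDERIV (\<lambda>\<sigma>. real_of_ereal (conjugate V \<sigma>)) s :> quad_vec A b c x)"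
proof -
  obtain h h' where h: "(h has_derivative h') (at s)"
    and ev: "\<forall>\<^sub>F \<sigma> in nhds s. comb A \<sigma> *v h \<sigma> = comb b \<sigma>"
    using comb_solution_differentiable[OF det] by blast
  have hs: "h s = x"
    using eventually_nhds_x_imp_x[OF ev] x by (simp add: cramer[OF det])
  have "\<forall>\<^sub>F \<sigma> in nhds s. \<sigma> \<in> interior (edom (conjugate V))"
    using s by (intro eventually_nhds_in_open) auto
  with ev have ev': "\<forall>\<^sub>F \<sigma> in nhds s. \<sigma> \<in> S_col A b V \<and>
      dual A b c V \<sigma> = ereal (lagrangian A b c (h \<sigma>) \<sigma> - real_of_ereal (conjugate V \<sigma>))"
  proof eventually_elim
    case (elim \<sigma>)
    then have \<sigma>: "\<sigma> \<in> edom (conjugate V)"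
      using interior_subset by blast
    have "\<sigma> \<in> S_col A b V"
      using elim(1) \<sigma> by (auto simp: S_col_def image_iff intro: exI[of _ "h \<sigma>"])
    then show ?case
      using dual_eq[where A = A, OF sym elim(1)] Xi_eq_lagrangian[OF V \<sigma>] by simp
  qed
  have pair: "((\<lambda>\<sigma>. (h \<sigma>, \<sigma>)) has_derivative (\<lambda>d. (h' d, d))) (at s)"
    by (intro has_derivative_Pair h has_derivative_ident)
  have "((\<lambda>\<sigma>. lagrangian A b c (fst (h \<sigma>, \<sigma>)) (snd (h \<sigma>, \<sigma>))) has_derivative
      (\<lambda>d. (h' d, d) \<bullet> (comb A s *v x - comb b s, quad_vec A b c x))) (at s)"
    by (rule has_derivative_compose[OF pair])
      (use lagrangian_GDERIV[where A = A, OF sym, of b c x s] in \<open>simp add: gderiv_def hs\<close>)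
  \<comment> \<open>The residual vanishes at \<open>(x, s)\<close>, so \<open>h'\<close> drops out
    and only the partial gradient in the second variable is left.\<close>
  then have L: "GDERIV (\<lambda>\<sigma>. lagrangian A b c (h \<sigma>) \<sigma>) s :> quad_vec A b c x"
    by (simp add: gderiv_def x)
  have "critical_point_on (S_col A b V) (dual A b c V) s \<longleftrightarrow>
      (GDERIV (\<lambda>\<sigma>. real_of_ereal (dual A b c V \<sigma>)) s :> 0)"
    unfolding critical_point_on_def has_gradient_on_def
    using eventually_mono[OF ev', of "\<lambda>\<sigma>. \<sigma> \<in> S_col A b V \<and> \<bar>dual A b c V \<sigma>\<bar> \<noteq> \<infinity>"] by force
  also have "\<dots> \<longleftrightarrow> (GDERIV (\<lambda>\<sigma>. lagrangian A b c (h \<sigma>) \<sigma> - real_of_ereal (conjugate V \<sigma>)) s :> 0)"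
    by (rule GDERIV_cong_eventually, rule eventually_mono[OF ev']) simp
  also have "\<dots> \<longleftrightarrow> (GDERIV (\<lambda>\<sigma>. real_of_ereal (conjugate V \<sigma>)) s :> quad_vec A b c x)"
    by (rule GDERIV_diff_zero_iff[OF L])
  finally show ?thesis .
qed

text \<open>By the chain rule, with \<open>s\<close> as gradient of \<open>V\<close> at
  \<open>q(x)\<close>, the derivative of \<open>f\<close> is again the residual
  \<open>A(s) x - b(s)\<close>, which is zero.\<close>

lemma primal_critical:
  fixes A :: "'m::finite option \<Rightarrow> real^'n^'n"
  assumes sym: "\<And>k. symmetric_matrix (A k)"
    and x: "comb A s *v x = comb b s"
    and V: "has_gradient_on (edom V) V (quad_vec A b c x) s"
  shows "critical_point_on (edom (primal A b c V)) (primal A b c V) x"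
proof -
  let ?q = "quad_vec A b c" and ?q' = "\<lambda>h. \<chi> i. h \<bullet> (A (Some i) *v x - b (Some i))"
  have q: "(?q has_derivative ?q') (at x)"
    by (rule quad_vec_has_derivative[where A = A, OF sym])
  then have "isCont ?q x"
    by (rule has_derivative_continuous)
  then have "filterlim ?q (nhds (?q x)) (nhds x)"
    by (rule isCont_tendsto_nhds)
  moreover have "\<forall>\<^sub>F y in nhds (?q x). \<bar>V y\<bar> \<noteq> \<infinity>"
    using V unfolding has_gradient_on_def by (simp add: eventually_conj_iff)
  \<comment> \<open>Continuity of \<open>q\<close> carries finiteness of \<open>V\<close> near
    \<open>q(x)\<close> back to a neighbourhood of \<open>x\<close>.\<close>
  ultimately have "\<forall>\<^sub>F z in nhds x. \<bar>V (?q z)\<bar> \<noteq> \<infinity>"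
    by (rule eventually_compose_filterlim[rotated])
  then have ev: "\<forall>\<^sub>F z in nhds x. primal A b c V z =
      ereal (quad A b c None z + real_of_ereal (V (?q z)))"
    by (rule eventually_mono) (auto simp: primal_def)
  have "((\<lambda>z. quad A b c None z + real_of_ereal (V (?q z))) has_derivative
      (\<lambda>h. h \<bullet> (A None *v x - b None) + ?q' h \<bullet> s)) (at x)"
    by (intro has_derivative_add quad_has_derivative sym has_derivative_compose[OF q])
      (use V in \<open>simp add: has_gradient_on_def gderiv_def\<close>)
  then have "GDERIV (\<lambda>z. quad A b c None z + real_of_ereal (V (?q z))) x :> 0"
    unfolding inner_comb_residual by (simp add: gderiv_def x)
  then have "GDERIV (\<lambda>z. real_of_ereal (primal A b c V z)) x :> 0"
    by (subst GDERIV_cong_eventually) (auto intro: eventually_mono[OF ev])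
  then show ?thesis
    unfolding critical_point_on_def has_gradient_on_def
    by (auto intro: eventually_mono[OF ev] simp: edom_def)
qed

section \<open>Weak duality and global minimality\<close>

lemma Xi_le_primal: "Xi A b c V (x, s) \<le> primal A b c V x" if "proper V"
  using Fenchel_Young[of "quad_vec A b c x" s V] conjugate_not_minus_infinity[OF that, of s]
  unfolding Xi_def primal_def
  by (cases "V (quad_vec A b c x)"; cases "conjugate V s") auto

text \<open>The Taylor expansion of a quadratic at a stationary point is exact and has no linear
  term. Definiteness of \<open>A(s)\<close> thus decides whether \<open>x\<close> minimizes the
  Lagrangian.\<close>

lemma lagrangian_diff:
  assumes sym: "\<And>k. symmetric_matrix (A k)" and x: "comb A s *v x = comb b s"
  shows "lagrangian A b c y s - lagrangian A b c x s = 1/2 * ((y - x) \<bullet> (comb A s *v (y - x)))"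
  using symmetric_matrix_inner[OF symmetric_matrix_comb[where A = A, OF sym], of x s y] x
  by (simp add: lagrangian_eq matrix_vector_mult_diff_distrib inner_diff_left inner_diff_right
      inner_commute)

lemma dual_le_primal:
  assumes sym: "\<And>k. symmetric_matrix (A k)" and V: "proper V" and s: "s \<in> S_col_plus A b V"
  shows "dual A b c V s \<le> primal A b c V y"
proof -
  obtain x where x: "comb A s *v x = comb b s" and dom: "s \<in> edom (conjugate V)"
    and psd: "pos_semidef (comb A s)"
    using s by (auto simp: S_col_plus_def S_col_def)
  have "0 \<le> (y - x) \<bullet> (comb A s *v (y - x))"
    using psd by (simp add: pos_semidef_def)
  then have "lagrangian A b c x s \<le> lagrangian A b c y s"
    using lagrangian_diff[where A = A, OF sym x, of c y] by linarith
  then have "dual A b c V s \<le> Xi A b c V (y, s)"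
    by (simp add: dual_eq[where A = A, OF sym x] Xi_eq_lagrangian[OF V dom])
  then show ?thesis
    using Xi_le_primal[OF V] by (rule order_trans)
qed

lemma critical_point_duality:
  fixes A :: "'m::finite option \<Rightarrow> real^'n^'n"
  assumes sym: "\<And>k. symmetric_matrix (A k)" and V: "V \<in> Gamma_sc"
    and s: "s \<in> interior (edom (conjugate V))"
    and x: "comb A s *v x = comb b s"
    and grad: "GDERIV (\<lambda>\<sigma>. real_of_ereal (conjugate V \<sigma>)) s :> quad_vec A b c x"
  shows "x \<in> X0 A b c V" "s \<in> S_col A b V"
    "critical_point_on (edom (primal A b c V)) (primal A b c V) x"
    "primal A b c V x = Xi A b c V (x, s)"
proof -
  have prp: "proper V" and conv: "convex_fun V" and lsc: "lsc V" and es: "essentially_smooth V"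
    using V by (auto simp: Gamma_sc_def Gamma_def)
  have nm: "V y \<noteq> - \<infinity>" for y
    using prp by (simp add: proper_def)
  have sub: "s \<in> subdifferential V (quad_vec A b c x)"
    by (rule conjugate_gradient_subgradient[OF lsc prp grad s])
  show "x \<in> X0 A b c V"
    using essentially_smooth_subgradient_interior[OF conv nm es sub] by (simp add: X0_def)
  have dom: "s \<in> edom (conjugate V)"
    using s interior_subset by blast
  then show "s \<in> S_col A b V"
    using x by (auto simp: S_col_def image_iff intro: exI[of _ x])
  show "critical_point_on (edom (primal A b c V)) (primal A b c V) x"
    by (rule primal_critical[where A = A, OF sym x essentially_smooth_subgradient_gradient[OF conv nm es sub]])
  \<comment> \<open>Equality in Fenchel-Young at \<open>q(x)\<close> turns \<open>V(q(x))\<close>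
    into the remaining terms of \<open>\<Xi>\<close>.\<close>
  show "primal A b c V x = Xi A b c V (x, s)"
    by (simp add: primal_def conjugate_gradient_attains[OF lsc prp grad s]
        Xi_eq_lagrangian[OF prp dom] lagrangian_def)
qed

text \<open>Positive definiteness makes the Lagrangian strictly larger off \<open>x\<close>, and
  \<open>f\<close> equals \<open>\<Xi>\<close> at \<open>x\<close> and dominates it
  elsewhere.\<close>

lemma minimizer_unique:
  fixes A :: "'m::finite option \<Rightarrow> real^'n^'n"
  assumes sym: "\<And>k. symmetric_matrix (A k)" and V: "proper V"
    and s: "s \<in> edom (conjugate V)" and pd: "pos_def (comb A s)"
    and x: "comb A s *v x = comb b s" and eq: "primal A b c V x = Xi A b c V (x, s)"
    and min: "\<And>y. primal A b c V x \<le> primal A b c V y"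
  shows "{x. \<forall>y. primal A b c V x \<le> primal A b c V y} = {x}"
proof -
  have "primal A b c V x < primal A b c V y" if "y \<noteq> x" for y
  proof -
    have "0 < (y - x) \<bullet> (comb A s *v (y - x))"
      using pd that by (simp add: pos_def_def)
    then have "lagrangian A b c x s < lagrangian A b c y s"
      using lagrangian_diff[where A = A, OF sym x, of c y] by linarith
    then have "Xi A b c V (x, s) < Xi A b c V (y, s)"
      by (simp add: Xi_eq_lagrangian[OF V s])
    then show ?thesis
      using eq Xi_le_primal[OF V, of A b c y s] by simp
  qed
  then have "z = x" if "\<forall>y. primal A b c V z \<le> primal A b c V y" for z
    using that leD by blast
  then show ?thesis
    using min by blast
qed

theorem proposition3:
  fixes A :: "'m::finite option \<Rightarrow> real^'n^'n"
    and b :: "'m option \<Rightarrow> real^'n"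
    and c :: "'m option \<Rightarrow> real"
    and V :: "real^'m \<Rightarrow> ereal"
    and xbar :: "real^'n" and sbar :: "real^'m"
  assumes A_sym: "\<And>i. symmetric_matrix (A i)"
    and V: "V \<in> Gamma_sc"
    and sbar: "sbar \<in> interior (edom (conjugate V))"
  defines "f \<equiv> primal A b c V"
    and "D \<equiv> dual A b c V"
    and "\<Xi> \<equiv> Xi A b c V"
    and "Z \<equiv> (UNIV :: (real^'n) set) \<times> interior (edom (conjugate V))"
  shows
    \<comment> \<open>(i)\<close>
    "(critical_point_on Z \<Xi> (xbar, sbar) \<longrightarrow>
        (xbar, sbar) \<in> X0 A b c V \<times> S_col A b V \<and>
        critical_point_on (edom f) f xbar \<and>
        f xbar = \<Xi> (xbar, sbar) \<and> \<Xi> (xbar, sbar) = D sbar \<and>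
        (sbar \<in> S0 A V \<longrightarrow> critical_point_on (S_col A b V) D sbar))
     \<and>
     (critical_point_on Z \<Xi> (xbar, sbar) \<and> pos_semidef (comb A sbar) \<longrightarrow>
        sbar \<in> S_col_plus A b V \<and>
        f xbar = (INF x\<in>edom f. f x) \<and> (INF x\<in>edom f. f x) = \<Xi> (xbar, sbar) \<and>
        \<Xi> (xbar, sbar) = (SUP \<sigma>\<in>S_col_plus A b V. D \<sigma>) \<and>
        (SUP \<sigma>\<in>S_col_plus A b V. D \<sigma>) = D sbar \<and>
        (pos_def (comb A sbar) \<longrightarrow> {x. \<forall>y. f x \<le> f y} = {xbar}))
     \<and>
     (sbar \<in> S0 A V \<and> critical_point_on (S_col A b V) D sbar \<longrightarrow>
        (let x' = matrix_inv (comb A sbar) *v comb b sbar in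
          critical_point_on Z \<Xi> (x', sbar) \<and>
          (x', sbar) \<in> X0 A b c V \<times> S_col A b V \<and>
          critical_point_on (edom f) f x' \<and>
          f x' = \<Xi> (x', sbar) \<and> \<Xi> (x', sbar) = D sbar \<and>
          (sbar \<in> S0 A V \<longrightarrow> critical_point_on (S_col A b V) D sbar) \<and>
          (pos_semidef (comb A sbar) \<longrightarrow>
             sbar \<in> S_col_plus A b V \<and>
             f x' = (INF x\<in>edom f. f x) \<and> (INF x\<in>edom f. f x) = \<Xi> (x', sbar) \<and>
             \<Xi> (x', sbar) = (SUP \<sigma>\<in>S_col_plus A b V. D \<sigma>) \<and>
             (SUP \<sigma>\<in>S_col_plus A b V. D \<sigma>) = D sbar \<and>
             (pos_def (comb A sbar) \<longrightarrow> {x. \<forall>y. f x \<le> f y} = {x'}))))"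
proof -
  have prp: "proper V"
    using V by (simp add: Gamma_sc_def Gamma_def)
  have dom: "sbar \<in> edom (conjugate V)"
    using sbar interior_subset by blast
  note Xi_iff = Xi_critical_iff[where A = A and b = b and c = c, OF A_sym prp sbar, folded \<Xi>_def Z_def]
  \<comment> \<open>This and \<open>part2\<close> are stated for arbitrary \<open>x\<close>, since
    (iii) applies them to \<open>A(sbar)\<close> inverse times \<open>b(sbar)\<close> in place of
    \<open>xbar\<close>.\<close>
  have part1: "(x, sbar) \<in> X0 A b c V \<times> S_col A b V \<and> critical_point_on (edom f) f x \<and>
      f x = \<Xi> (x, sbar) \<and> \<Xi> (x, sbar) = D sbar \<and>
      (sbar \<in> S0 A V \<longrightarrow> critical_point_on (S_col A b V) D sbar)"
    if crit: "critical_point_on Z \<Xi> (x, sbar)" for x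
  proof -
    have x: "comb A sbar *v x = comb b sbar"
      and grad: "GDERIV (\<lambda>\<sigma>. real_of_ereal (conjugate V \<sigma>)) sbar :> quad_vec A b c x"
      using crit Xi_iff by auto
    show ?thesis
      using critical_point_duality[where A = A, OF A_sym V sbar x grad] dual_eq[where A = A, OF A_sym x, of c V]
        dual_critical_iff[where A = A, OF A_sym prp sbar _ x, of c] grad
      by (auto simp: f_def D_def \<Xi>_def S0_def)
  qed
  have part2: "pos_semidef (comb A sbar) \<longrightarrow> sbar \<in> S_col_plus A b V \<and>
      f x = (INF x\<in>edom f. f x) \<and> (INF x\<in>edom f. f x) = \<Xi> (x, sbar) \<and>
      \<Xi> (x, sbar) = (SUP \<sigma>\<in>S_col_plus A b V. D \<sigma>) \<and>
      (SUP \<sigma>\<in>S_col_plus A b V. D \<sigma>) = D sbar \<and>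
      (pos_def (comb A sbar) \<longrightarrow> {x. \<forall>y. f x \<le> f y} = {x})"
    if crit: "critical_point_on Z \<Xi> (x, sbar)" for x
  proof
    assume psd: "pos_semidef (comb A sbar)"
    have x: "comb A sbar *v x = comb b sbar"
      using crit Xi_iff by auto
    have fx: "f x = \<Xi> (x, sbar)" "\<Xi> (x, sbar) = D sbar" and col: "sbar \<in> S_col_plus A b V"
      using part1[OF crit] psd by (auto simp: S_col_plus_def)
    have weak: "D \<sigma> \<le> f y" if "\<sigma> \<in> S_col_plus A b V" for \<sigma> y
      unfolding D_def f_def by (rule dual_le_primal[where A = A, OF A_sym prp that])
    have min: "f x \<le> f y" for y
      using weak[OF col] fx by simp
    \<comment> \<open>The infimum ranges over \<open>edom f\<close> only, so \<open>f x\<close> must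
      be finite to take part; it equals a finite value of \<open>\<Xi>\<close>.\<close>
    have "x \<in> edom f"
      using fx(1) Xi_eq_lagrangian[OF prp dom, of A b c x] by (simp add: edom_def \<Xi>_def)
    then have inf: "(INF x\<in>edom f. f x) = f x"
      by (intro antisym INF_lower INF_greatest min)
    have sup: "(SUP \<sigma>\<in>S_col_plus A b V. D \<sigma>) = D sbar"
      using weak[of _ x] fx by (intro antisym SUP_upper SUP_least col) auto
    have "{x. \<forall>y. f x \<le> f y} = {x}" if "pos_def (comb A sbar)"
      using minimizer_unique[where A = A, OF A_sym prp dom that x, of c] fx(1) min by (simp add: f_def \<Xi>_def)
    then show "sbar \<in> S_col_plus A b V \<and>
      f x = (INF x\<in>edom f. f x) \<and> (INF x\<in>edom f. f x) = \<Xi> (x, sbar) \<and>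
      \<Xi> (x, sbar) = (SUP \<sigma>\<in>S_col_plus A b V. D \<sigma>) \<and>
      (SUP \<sigma>\<in>S_col_plus A b V. D \<sigma>) = D sbar \<and>
      (pos_def (comb A sbar) \<longrightarrow> {x. \<forall>y. f x \<le> f y} = {x})"
      using col inf sup fx by simp
  qed
  have part3: "critical_point_on Z \<Xi> (matrix_inv (comb A sbar) *v comb b sbar, sbar)"
    if "sbar \<in> S0 A V" and crit: "critical_point_on (S_col A b V) D sbar"
  proof -
    have det: "det (comb A sbar) \<noteq> 0"
      using that by (simp add: S0_def)
    \<comment> \<open>\<open>matrix_inv\<close> is a choice of two-sided inverse, and one exists
      since the determinant is nonzero.\<close>
    then have "comb A sbar ** matrix_inv (comb A sbar) = mat 1"
      unfolding invertible_det_nz[symmetric] invertible_def matrix_inv_def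
      by (rule someI2_ex) auto
    then have x: "comb A sbar *v (matrix_inv (comb A sbar) *v comb b sbar) = comb b sbar"
      by (simp add: matrix_vector_mul_assoc)
    then show ?thesis
      using Xi_iff dual_critical_iff[where A = A, OF A_sym prp sbar det x, of c] crit by (simp add: D_def)
  qed
  show ?thesis
  proof (unfold Let_def, rule conjI[OF impI[OF part1] conjI[OF impI[OF mp[OF part2]] impI]], goal_cases)
    \<comment> \<open>The first three goals only ask for the hypotheses of (i) and (ii); this one is
      (iii).\<close>
    case 4
    then have crit: "critical_point_on Z \<Xi> (matrix_inv (comb A sbar) *v comb b sbar, sbar)"
      using part3 by blast
    show ?case
      using conjI[OF crit conjI[OF part1[OF crit] part2[OF crit]]]
      unfolding conj_assoc .
  qed simp_all
qed

end
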